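(* Every function in $\mathcal A_0$ has $B_0$-property.
   Context: A Nevanlinna function $m$ is holomorphic at least on $\mathbb C\setminus\mathbb R$, with $m(z^* )=m(z)^*$ ($z^*$ is the complex conjugate) and $\operatorname{Im}m(z)\ge0$ for $\operatorname{Im}z>0$; it is considered on its full domain of holomorphy (the union of $\mathbb C\setminus\mathbb R$ and the real points to which it continues holomorphically). It is an inverse Stieltjes function if it is holomorphic on $\mathbb C\setminus[0,+\infty)$ and takes nonpositive values on $\mathbb R_-=(-\infty,0)$. Powers are principal: $z^\alpha=|z|^\alpha e^{i\alpha\operatorname{Arg}z}$, $\operatorname{Arg}z\in(-\pi,\pi)$; $f\sim g$ means $f/g\to1$. $\mathcal A_0$ is the set of Nevanlinna functions $m$ for which there are $\alpha\in(0,1)$, $C>0$ and a Möbius transformation $\mu(z)=\frac{az+b}{cz+d}$ with $a,b,c,d\in\mathbb R$, $ad-bc\in\{-1,1\}$, such that $\mu\circ m$ is an inverse Stieltjes function and for all $z\in\mathbb C\setminus\mathbb R$: $(\mu\circ m)(rz)\sim-C(-rz)^\alpha$ as $r\to0+$. For a Nevanlinna function $m$, $\mathcal H(m)$ is the reproducing kernel Hilbert space of holomorphic functions on $\mathbb C\setminus\mathbb R$ with kernel $K_m(z,w)=\frac{m(z)-m(w)^*}{z-w^*}$ ($z\ne w^*$; extended by continuity). With $w_m(y)=1/\operatorname{Im}m(iy)$, $y>0$, $m$ has $B_0$-property if $h\mapsto\big(y\mapsto h(iy)\big)$ is a bounded operator from $\mathcal H(m)$ into the weighted space $L^2_{w_m}(0,1)$.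 *)

theory Defs
  imports "HOL-Complex_Analysis.Complex_Analysis" "HOL-Library.Landau_Symbols"
begin

text \<open>
  Functions on \<open>- \<real>\<close> (the nonreal complex numbers) are total functions of which only the values
  on \<open>- \<real>\<close> matter. In particular a Nevanlinna function is determined by its values there; its values
  at those real points to which it continues holomorphically are expressed through an explicit
  continuation, which is unique by the identity theorem.
\<close>

definition nevanlinna :: "(complex \<Rightarrow> complex) \<Rightarrow> bool" where
  "nevanlinna m \<longleftrightarrow>
     m holomorphic_on (- \<real>) \<and>
     (\<forall>z \<in> - \<real>. m (cnj z) = cnj (m z)) \<and>
     (\<forall>z. Im z > 0 \<longrightarrow> Im (m z) \<ge> 0)"

definition inverse_stieltjes :: "(complex \<Rightarrow> complex) \<Rightarrow> bool" where
  "inverse_stieltjes m \<longleftrightarrow>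
     nevanlinna m \<and>
     (\<exists>g. g holomorphic_on (- \<real>\<^sub>\<ge>\<^sub>0) \<and> (\<forall>z \<in> - \<real>. g z = m z) \<and>
          (\<forall>x::real. x < 0 \<longrightarrow> g (of_real x) \<in> \<real>\<^sub>\<le>\<^sub>0))"

definition moebius :: "real \<Rightarrow> real \<Rightarrow> real \<Rightarrow> real \<Rightarrow> complex \<Rightarrow> complex" where
  "moebius a b c d z = (of_real a * z + of_real b) / (of_real c * z + of_real d)"

text \<open>
  In the next definition the pole of the Moebius transformation is harmless: a Nevanlinna function
  taking a real value at a nonreal point is constant, and constants do not satisfy the asymptotics.
\<close>

definition class_A0 :: "(complex \<Rightarrow> complex) set" where
  "class_A0 = {m. nevanlinna m \<and>
     (\<exists>(\<alpha>::real) (C::real) a b c d.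
        0 < \<alpha> \<and> \<alpha> < 1 \<and> C > 0 \<and> a * d - b * c \<in> {-1, 1} \<and>
        inverse_stieltjes (moebius a b c d \<circ> m) \<and>
        (\<forall>z \<in> - \<real>.
           (\<lambda>r::real. (moebius a b c d \<circ> m) (of_real r * z))
             \<sim>[at_right 0]
           (\<lambda>r. - of_real C * (- (of_real r * z)) powr of_real \<alpha>)))}"

text \<open>
  A Hilbert space of complex functions on \<open>\<Omega>\<close> is given by its carrier \<open>H\<close> and its inner product
  \<open>ip\<close>, linear in the first argument. Its elements are represented by functions that vanish outside
  \<open>\<Omega>\<close>, so that equality of functions is equality on \<open>\<Omega>\<close>.
\<close>

definition hilbert_norm ::
  "(('a \<Rightarrow> complex) \<Rightarrow> ('a \<Rightarrow> complex) \<Rightarrow> complex) \<Rightarrow> ('a \<Rightarrow> complex) \<Rightarrow> real" where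
  "hilbert_norm ip f = sqrt (Re (ip f f))"

definition hilbert_function_space ::
  "'a set \<Rightarrow> ('a \<Rightarrow> complex) set \<Rightarrow> (('a \<Rightarrow> complex) \<Rightarrow> ('a \<Rightarrow> complex) \<Rightarrow> complex) \<Rightarrow> bool" where
  "hilbert_function_space \<Omega> H ip \<longleftrightarrow>
     (\<forall>f\<in>H. \<forall>x. x \<notin> \<Omega> \<longrightarrow> f x = 0) \<and>
     (\<lambda>x. 0) \<in> H \<and>
     (\<forall>f\<in>H. \<forall>g\<in>H. (\<lambda>x. f x + g x) \<in> H) \<and>
     (\<forall>f\<in>H. \<forall>c. (\<lambda>x. c * f x) \<in> H) \<and>
     (\<forall>f\<in>H. \<forall>g\<in>H. \<forall>h\<in>H. ip (\<lambda>x. f x + g x) h = ip f h + ip g h) \<and>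
     (\<forall>f\<in>H. \<forall>g\<in>H. \<forall>c. ip (\<lambda>x. c * f x) g = c * ip f g) \<and>
     (\<forall>f\<in>H. \<forall>g\<in>H. ip g f = cnj (ip f g)) \<and>
     (\<forall>f\<in>H. Re (ip f f) \<ge> 0) \<and>
     (\<forall>f\<in>H. ip f f = 0 \<longrightarrow> f = (\<lambda>x. 0)) \<and>
     (\<forall>F :: nat \<Rightarrow> 'a \<Rightarrow> complex.
        (\<forall>n. F n \<in> H) \<and>
        (\<forall>e>0. \<exists>N. \<forall>i\<ge>N. \<forall>j\<ge>N. hilbert_norm ip (\<lambda>x. F i x - F j x) < e)
        \<longrightarrow> (\<exists>f\<in>H. (\<lambda>n. hilbert_norm ip (\<lambda>x. F n x - f x)) \<longlonglongrightarrow> 0))"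

definition reproducing_kernel_hilbert_space ::
  "'a set \<Rightarrow> ('a \<Rightarrow> 'a \<Rightarrow> complex) \<Rightarrow>
   ('a \<Rightarrow> complex) set \<Rightarrow> (('a \<Rightarrow> complex) \<Rightarrow> ('a \<Rightarrow> complex) \<Rightarrow> complex) \<Rightarrow> bool" where
  "reproducing_kernel_hilbert_space \<Omega> K H ip \<longleftrightarrow>
     hilbert_function_space \<Omega> H ip \<and>
     (\<forall>w\<in>\<Omega>. (\<lambda>z. if z \<in> \<Omega> then K z w else 0) \<in> H \<and>
            (\<forall>f\<in>H. f w = ip f (\<lambda>z. if z \<in> \<Omega> then K z w else 0)))"

text \<open>
  As \<open>cnj (m w) = m (cnj w)\<close>, the continuous extension of the difference quotient to
  \<open>z = cnj w\<close> is the derivative of \<open>m\<close>.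
\<close>

definition nevanlinna_kernel :: "(complex \<Rightarrow> complex) \<Rightarrow> complex \<Rightarrow> complex \<Rightarrow> complex" where
  "nevanlinna_kernel m z w =
     (if z = cnj w then deriv m z else (m z - cnj (m w)) / (z - cnj w))"

text \<open>
  \<open>is_nevanlinna_space m H ip\<close> states that \<open>(H, ip)\<close> is the space \<open>\<H>(m)\<close>. By the Moore-Aronszajn
  theorem there is exactly one such space, as the kernel of a Nevanlinna function is positive
  semidefinite (uniqueness is for \<open>H\<close> and for \<open>ip\<close> on \<open>H\<close>).
\<close>

definition is_nevanlinna_space ::
  "(complex \<Rightarrow> complex) \<Rightarrow> (complex \<Rightarrow> complex) set \<Rightarrow>
   ((complex \<Rightarrow> complex) \<Rightarrow> (complex \<Rightarrow> complex) \<Rightarrow> complex) \<Rightarrow> bool" where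
  "is_nevanlinna_space m H ip \<longleftrightarrow>
     reproducing_kernel_hilbert_space (- \<real>) (nevanlinna_kernel m) H ip \<and>
     (\<forall>h\<in>H. h holomorphic_on (- \<real>))"

definition in_weighted_L2 :: "(real \<Rightarrow> real) \<Rightarrow> real set \<Rightarrow> (real \<Rightarrow> complex) \<Rightarrow> bool" where
  "in_weighted_L2 w S f \<longleftrightarrow>
     set_borel_measurable lborel S f \<and> set_integrable lborel S (\<lambda>y. (norm (f y))\<^sup>2 * w y)"

definition weighted_L2_norm :: "(real \<Rightarrow> real) \<Rightarrow> real set \<Rightarrow> (real \<Rightarrow> complex) \<Rightarrow> real" where
  "weighted_L2_norm w S f = sqrt (LINT y:S|lborel. (norm (f y))\<^sup>2 * w y)"

definition nevanlinna_weight :: "(complex \<Rightarrow> complex) \<Rightarrow> real \<Rightarrow> real" where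
  "nevanlinna_weight m y = 1 / Im (m (\<i> * of_real y))"

text \<open>
  If \<open>m\<close> is a real constant, the weight is infinite but \<open>\<H>(m) = {0}\<close>, so that reading \<open>1 / 0\<close>
  as \<open>0\<close> makes no difference. For all other Nevanlinna functions the weight is positive.
\<close>

definition has_B0_property :: "(complex \<Rightarrow> complex) \<Rightarrow> bool" where
  "has_B0_property m \<longleftrightarrow>
     (\<forall>H ip. is_nevanlinna_space m H ip \<longrightarrow>
        (\<exists>C. \<forall>h\<in>H.
           in_weighted_L2 (nevanlinna_weight m) {0<..<1} (\<lambda>y. h (\<i> * of_real y)) \<and>
           weighted_L2_norm (nevanlinna_weight m) {0<..<1} (\<lambda>y. h (\<i> * of_real y))
             \<le> C * hilbert_norm ip h))"

end

theory Submission
  imports Defs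
begin

text \<open>
  For points \<open>\<i> x\<close> and \<open>\<i> y\<close> of the positive imaginary axis consider the kernel normalised by its weights,
  \<open>\<bar>K\<^sub>m(\<i> x, \<i> y)\<bar> / sqrt (Im m(\<i> x) Im m(\<i> y))\<close>. It does not change when \<open>m\<close> is replaced by
  \<open>n = \<mu> \<circ> m\<close> with a real Moebius transformation \<open>\<mu>\<close> (\<open>moebius_invariance\<close>: this is the invariance of
  the pseudohyperbolic distance of \<open>m(\<i> x)\<close> and \<open>m(\<i> y)\<close>). The asymptotics on the single ray through
  \<open>\<i>\<close> show that both \<open>\<bar>n(\<i> y)\<bar>\<close> and \<open>Im n(\<i> y)\<close> are comparable to \<open>y\<^sup>\<alpha>\<close> on the interval from 0 to 1;
  here \<open>0 < \<alpha> < 1\<close> enters as positivity of \<open>sin (\<alpha> \<pi> / 2)\<close>. So for \<open>x \<le> y\<close> the normalised kernel is at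
  most a constant times \<open>(y / x)\<^bsup>\<alpha>/2\<^esup> / y\<close>, a kernel that is homogeneous of degree \<open>-1\<close> as in
  Hilbert's inequality.

  Evaluation along the axis is bounded if and only if the normalised kernel defines a bounded operator
  on \<open>L\<^sup>2(0,1)\<close>, and the bound above gives this by Schur's test. The proof carries this out without
  integral operators. At the dyadic points \<open>t / 2\<^sup>k\<close>, weighted by \<open>2\<^sup>-\<^sup>k\<close>, the kernel becomes a matrix
  whose entries are at most a constant times \<open>\<rho>\<close> to the power of the distance from the diagonal, with
  \<open>\<rho>\<^sup>2 = 2\<^sup>\<alpha> / 2 < 1\<close>; this is where \<open>\<alpha> < 1\<close> is decisive. A finite-dimensional Schur
  test in the reproducing kernel Hilbert space (\<open>rkhs_sampling_bound\<close>) then bounds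
  \<open>\<Sum>k. 2\<^sup>-\<^sup>k \<bar>h(\<i> t / 2\<^sup>k)\<bar>\<^sup>2 w\<^sub>m(t / 2\<^sup>k)\<close> by a multiple of the squared norm of \<open>h\<close>, uniformly in \<open>t\<close>.
  Integrating over \<open>1/2 \<le> t < 1\<close> turns these sums into the integral over the whole unit interval.
\<close>

section \<open>Sampling in reproducing kernel Hilbert spaces\<close>

lemma hilbert_function_space_add:
  assumes "hilbert_function_space \<Omega> H ip" "f \<in> H" "g \<in> H"
  shows "(\<lambda>x. f x + g x) \<in> H"
    and "h \<in> H \<Longrightarrow> ip (\<lambda>x. f x + g x) h = ip f h + ip g h"
  using assms unfolding hilbert_function_space_def by blast+

lemma hilbert_function_space_sum:
  assumes H: "hilbert_function_space \<Omega> H ip"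
    and "finite I" and F: "\<And>i. i \<in> I \<Longrightarrow> F i \<in> H" and g: "g \<in> H"
  shows "(\<lambda>x. \<Sum>i\<in>I. c i * F i x) \<in> H
         \<and> ip (\<lambda>x. \<Sum>i\<in>I. c i * F i x) g = (\<Sum>i\<in>I. c i * ip (F i) g)"
  using \<open>finite I\<close> F
proof (induction I rule: finite_induct)
  case empty
  have "(\<lambda>x. 0) \<in> H"
    using H unfolding hilbert_function_space_def by blast
  moreover have "ip (\<lambda>x. 0 * g x) g = 0 * ip g g"
    using H g unfolding hilbert_function_space_def by blast
  ultimately show ?case by simp
next
  case (insert i I)
  have scaled: "(\<lambda>x. c i * F i x) \<in> H" "ip (\<lambda>x. c i * F i x) g = c i * ip (F i) g"
    using H g insert.prems unfolding hilbert_function_space_def by blast+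
  have rest: "(\<lambda>x. \<Sum>i\<in>I. c i * F i x) \<in> H"
    "ip (\<lambda>x. \<Sum>i\<in>I. c i * F i x) g = (\<Sum>i\<in>I. c i * ip (F i) g)"
    using insert.IH insert.prems by auto
  have "(\<lambda>x. c i * F i x + (\<Sum>i\<in>I. c i * F i x)) \<in> H"
    by (rule hilbert_function_space_add(1)[OF H scaled(1) rest(1)])
  moreover have "ip (\<lambda>x. c i * F i x + (\<Sum>i\<in>I. c i * F i x)) g
      = ip (\<lambda>x. c i * F i x) g + ip (\<lambda>x. \<Sum>i\<in>I. c i * F i x) g"
    by (rule hilbert_function_space_add(2)[OF H scaled(1) rest(1) g])
  ultimately show ?case
    using insert.hyps scaled(2) rest(2) by simp
qed

text \<open>
  The inequality \<open>2 a\<^sub>i a\<^sub>j \<le> a\<^sub>i\<^sup>2 + a\<^sub>j\<^sup>2\<close> reduces the quadratic form to row and column sums, which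
  agree by symmetry.
\<close>

lemma schur_test:
  fixes a :: "'i \<Rightarrow> real" and E :: "'i \<Rightarrow> 'i \<Rightarrow> real"
  assumes "finite I"
    and nonneg: "\<And>i j. i \<in> I \<Longrightarrow> j \<in> I \<Longrightarrow> 0 \<le> E i j"
    and sym: "\<And>i j. i \<in> I \<Longrightarrow> j \<in> I \<Longrightarrow> E i j = E j i"
    and row: "\<And>i. i \<in> I \<Longrightarrow> (\<Sum>j\<in>I. E i j) \<le> B"
  shows "(\<Sum>i\<in>I. \<Sum>j\<in>I. a i * a j * E i j) \<le> B * (\<Sum>i\<in>I. (a i)\<^sup>2)"
proof -
  have "(\<Sum>i\<in>I. \<Sum>j\<in>I. a i * a j * E i j)
      \<le> (\<Sum>i\<in>I. \<Sum>j\<in>I. (a i)\<^sup>2 * E i j / 2 + (a j)\<^sup>2 * E i j / 2)"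
  proof (intro sum_mono)
    fix i j assume "i \<in> I" "j \<in> I"
    have "2 * (a i * a j) \<le> (a i)\<^sup>2 + (a j)\<^sup>2"
      using sum_squares_bound[of "a i" "a j"] by simp
    from mult_right_mono[OF this nonneg[OF \<open>i \<in> I\<close> \<open>j \<in> I\<close>]]
    show "a i * a j * E i j \<le> (a i)\<^sup>2 * E i j / 2 + (a j)\<^sup>2 * E i j / 2"
      by (simp add: algebra_simps)
  qed
  also have "\<dots> = (\<Sum>i\<in>I. \<Sum>j\<in>I. (a i)\<^sup>2 * E i j / 2) + (\<Sum>i\<in>I. \<Sum>j\<in>I. (a j)\<^sup>2 * E i j / 2)"
    by (simp add: sum.distrib)
  also have "(\<Sum>i\<in>I. \<Sum>j\<in>I. (a j)\<^sup>2 * E i j / 2) = (\<Sum>i\<in>I. \<Sum>j\<in>I. (a i)\<^sup>2 * E i j / 2)"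
    by (subst sum.swap) (intro sum.cong refl, simp add: sym)
  also have "(\<Sum>i\<in>I. \<Sum>j\<in>I. (a i)\<^sup>2 * E i j / 2) + (\<Sum>i\<in>I. \<Sum>j\<in>I. (a i)\<^sup>2 * E i j / 2)
      = (\<Sum>i\<in>I. (a i)\<^sup>2 * (\<Sum>j\<in>I. E i j))"
    by (simp add: sum_distrib_left flip: sum.distrib) (simp add: mult.commute)
  also have "\<dots> \<le> (\<Sum>i\<in>I. (a i)\<^sup>2 * B)"
    by (intro sum_mono mult_left_mono row) auto
  finally show ?thesis by (simp add: sum_distrib_left mult.commute)
qed

text \<open>
  The sampling operator is the adjoint of the synthesis operator that sends coefficients to the
  combination of the kernel functions at the nodes. The squared norm of the latter is the norm of the
  weighted Gram matrix, which the row sums bound. Concretely, let \<open>S\<close> be the left-hand side and let \<open>g\<close> be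
  the combination with coefficients \<open>- v\<^sub>i f(x\<^sub>i) / B\<close>. The inner product of \<open>g\<close> and \<open>f\<close> is \<open>- S / B\<close>, the
  squared norm of \<open>g\<close> is at most \<open>S / B\<close> by Schur's test, and expanding the nonnegative squared norm of
  \<open>f + g\<close> yields the claim.
\<close>

lemma rkhs_sampling_bound:
  assumes rk: "reproducing_kernel_hilbert_space \<Omega> K H ip"
    and I: "finite I" and x: "\<And>i. i \<in> I \<Longrightarrow> x i \<in> \<Omega>"
    and v: "\<And>i. i \<in> I \<Longrightarrow> 0 \<le> v i" and B: "0 < B"
    and row: "\<And>i. i \<in> I \<Longrightarrow> (\<Sum>j\<in>I. sqrt (v i) * sqrt (v j) * cmod (K (x i) (x j))) \<le> B"
    and f: "f \<in> H"
  shows "(\<Sum>i\<in>I. v i * (cmod (f (x i)))\<^sup>2) \<le> B * Re (ip f f)"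
proof -
  have H: "hilbert_function_space \<Omega> H ip"
    using rk unfolding reproducing_kernel_hilbert_space_def by blast
  define k where "k w = (\<lambda>z. if z \<in> \<Omega> then K z w else 0)" for w
  have kH: "k w \<in> H" and repr: "h w = ip h (k w)" if "w \<in> \<Omega>" "h \<in> H" for w h
    using rk that unfolding reproducing_kernel_hilbert_space_def k_def by blast+
  have herm: "ip h g = cnj (ip g h)" if "g \<in> H" "h \<in> H" for g h
    using H that unfolding hilbert_function_space_def by blast
  note add = hilbert_function_space_add[OF H]
  have K_herm: "K (x j) (x i) = cnj (K (x i) (x j))" if "i \<in> I" "j \<in> I" for i j
  proof -
    have "K (x j) (x i) = k (x i) (x j)" "K (x i) (x j) = k (x j) (x i)"
      using x that by (simp_all add: k_def)
    then show ?thesis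
      using repr[OF x[OF that(2)] kH[OF x[OF that(1)] f]] repr[OF x[OF that(1)] kH[OF x[OF that(2)] f]]
        herm[OF kH[OF x[OF that(2)] f] kH[OF x[OF that(1)] f]] by simp
  qed
  define S where "S = (\<Sum>i\<in>I. v i * (cmod (f (x i)))\<^sup>2)"
  define c where "c i = - of_real (v i / B) * f (x i)" for i
  define g where "g = (\<lambda>z. \<Sum>i\<in>I. c i * k (x i) z)"
  have gH: "g \<in> H" and ip_g: "ip g h = (\<Sum>i\<in>I. c i * ip (k (x i)) h)" if "h \<in> H" for h
    using hilbert_function_space_sum[OF H I, of "\<lambda>i. k (x i)" h c] kH[OF x that] that
    unfolding g_def by auto
  have ip_k: "ip (k (x i)) h = cnj (h (x i))" if "i \<in> I" "h \<in> H" for i h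
    using herm[OF \<open>h \<in> H\<close> kH[OF x[OF \<open>i \<in> I\<close>] f]] repr[OF x[OF \<open>i \<in> I\<close>] \<open>h \<in> H\<close>]
    by simp
  have "ip g f = (\<Sum>i\<in>I. - of_real (v i / B) * (f (x i) * cnj (f (x i))))"
    by (simp add: ip_g[OF f] ip_k f c_def mult.assoc)
  also have "\<dots> = - of_real (S / B)"
    by (simp add: S_def sum_divide_distrib sum_negf complex_norm_square mult.assoc del: of_real_power)
  finally have cross: "ip g f = - of_real (S / B)" .
  have "ip g g = (\<Sum>i\<in>I. c i * cnj (\<Sum>j\<in>I. c j * k (x j) (x i)))"
    using gH[OF f] by (simp add: ip_g ip_k) (simp add: g_def)
  also have "\<dots> = (\<Sum>i\<in>I. \<Sum>j\<in>I. c i * cnj (c j) * cnj (K (x i) (x j)))"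
    by (simp add: k_def x sum_distrib_left mult.assoc)
  finally have "Re (ip g g) \<le> cmod (\<Sum>i\<in>I. \<Sum>j\<in>I. c i * cnj (c j) * cnj (K (x i) (x j)))"
    by (simp only: complex_Re_le_cmod)
  also have "\<dots> \<le> (\<Sum>i\<in>I. \<Sum>j\<in>I. cmod (c i) * cmod (c j) * cmod (K (x i) (x j)))"
    by (rule order_trans[OF norm_sum], rule sum_mono, rule order_trans[OF norm_sum])
      (simp add: norm_mult)
  also have "\<dots> = (\<Sum>i\<in>I. \<Sum>j\<in>I. (sqrt (v i) * cmod (f (x i))) * (sqrt (v j) * cmod (f (x j)))
        * (sqrt (v i) * sqrt (v j) * cmod (K (x i) (x j)))) / B\<^sup>2"
    unfolding sum_divide_distrib
  proof (intro sum.cong refl)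
    fix i j assume "i \<in> I" "j \<in> I"
    have "v i = sqrt (v i) * sqrt (v i)" "v j = sqrt (v j) * sqrt (v j)"
      using v \<open>i \<in> I\<close> \<open>j \<in> I\<close> by simp_all
    moreover have "cmod (c i) = v i / B * cmod (f (x i))" "cmod (c j) = v j / B * cmod (f (x j))"
      using v B \<open>i \<in> I\<close> \<open>j \<in> I\<close> by (simp_all add: c_def norm_mult norm_divide)
    ultimately have "cmod (c i) = sqrt (v i) * sqrt (v i) / B * cmod (f (x i))"
      "cmod (c j) = sqrt (v j) * sqrt (v j) / B * cmod (f (x j))" by metis+
    then show "cmod (c i) * cmod (c j) * cmod (K (x i) (x j))
      = (sqrt (v i) * cmod (f (x i))) * (sqrt (v j) * cmod (f (x j)))
        * (sqrt (v i) * sqrt (v j) * cmod (K (x i) (x j))) / B\<^sup>2"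
      by (simp only: power2_eq_square) (simp add: field_simps)
  qed
  also have "\<dots> \<le> (B * (\<Sum>i\<in>I. (sqrt (v i) * cmod (f (x i)))\<^sup>2)) / B\<^sup>2"
  proof (intro divide_right_mono schur_test I row)
    fix i j assume "i \<in> I" "j \<in> I"
    then show "sqrt (v i) * sqrt (v j) * cmod (K (x i) (x j))
        = sqrt (v j) * sqrt (v i) * cmod (K (x j) (x i))"
      using K_herm[of i j] by simp
  qed (use v in auto)
  also have "(\<Sum>i\<in>I. (sqrt (v i) * cmod (f (x i)))\<^sup>2) = S"
    unfolding S_def by (intro sum.cong refl) (simp add: power_mult_distrib v)
  also have "B * S / B\<^sup>2 = S / B"
    using B by (simp add: power2_eq_square)
  finally have diag: "Re (ip g g) \<le> S / B" .
  let ?u = "\<lambda>z. f z + g z"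
  note gH = gH[OF f]
  have u: "?u \<in> H" using add(1)[OF f gH] .
  have "ip ?u ?u = ip f ?u + ip g ?u"
    by (rule add(2)[OF f gH u])
  also have "ip f ?u = cnj (ip f f + ip g f)"
    using herm[OF u f] add(2)[OF f gH f] by simp
  also have "ip g ?u = cnj (ip f g + ip g g)"
    using herm[OF u gH] add(2)[OF f gH gH] by simp
  also have "ip f g = cnj (ip g f)"
    by (rule herm[OF gH f])
  finally have "Re (ip ?u ?u) = Re (ip f f) - 2 * (S / B) + Re (ip g g)"
    using cross by simp
  moreover have "0 \<le> Re (ip ?u ?u)"
    using H u unfolding hilbert_function_space_def by blast
  ultimately have "S / B \<le> Re (ip f f)"
    using diag by linarith
  then show ?thesis
    using B by (simp add: S_def field_simps)
qed

section \<open>Dyadic decomposition\<close>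

lemma sum_power_distance_le:
  fixes \<rho> :: real
  assumes "0 \<le> \<rho>" "\<rho> < 1"
  shows "(\<Sum>j<N. \<rho> ^ nat \<bar>int i - int j\<bar>) \<le> 2 / (1 - \<rho>)"
proof -
  have geom: "(\<Sum>k\<in>A. \<rho> ^ k) \<le> 1 / (1 - \<rho>)" if "finite A" for A :: "nat set"
    using sum_le_suminf[OF summable_geometric[of \<rho>] that] suminf_geometric[of \<rho>] assms
    by simp
  let ?L = "{..<N} \<inter> {..i}" and ?R = "{..<N} - {..i}"
  have "(\<Sum>j<N. \<rho> ^ nat \<bar>int i - int j\<bar>)
      = (\<Sum>j\<in>?L. \<rho> ^ nat \<bar>int i - int j\<bar>) + (\<Sum>j\<in>?R. \<rho> ^ nat \<bar>int i - int j\<bar>)"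
    by (rule sum.Int_Diff) simp
  also have "(\<Sum>j\<in>?L. \<rho> ^ nat \<bar>int i - int j\<bar>) = (\<Sum>k\<in>(\<lambda>j. i - j) ` ?L. \<rho> ^ k)"
    by (subst sum.reindex) (auto simp: inj_on_def nat_diff_distrib intro!: sum.cong arg_cong[where f = "\<lambda>k. \<rho> ^ k"])
  also have "(\<Sum>j\<in>?R. \<rho> ^ nat \<bar>int i - int j\<bar>) = (\<Sum>k\<in>(\<lambda>j. j - i) ` ?R. \<rho> ^ k)"
    by (subst sum.reindex) (auto simp: inj_on_def nat_diff_distrib intro!: sum.cong arg_cong[where f = "\<lambda>k. \<rho> ^ k"])
  also have "(\<Sum>k\<in>(\<lambda>j. i - j) ` ?L. \<rho> ^ k) + (\<Sum>k\<in>(\<lambda>j. j - i) ` ?R. \<rho> ^ k)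
      \<le> 1 / (1 - \<rho>) + 1 / (1 - \<rho>)"
    by (intro add_mono geom) auto
  finally show ?thesis by simp
qed

text \<open>
  The unit interval is the disjoint union of the dilates of \<open>[1/2, 1)\<close> by powers of \<open>1/2\<close>. After rescaling
  every piece to \<open>[1/2, 1)\<close>, its integral is that of the dyadic sums, which the hypothesis
  controls pointwise. This avoids any approximation of integrals by Riemann sums.
\<close>

lemma nn_integral_unit_interval_le_dyadic:
  fixes F :: "real \<Rightarrow> ennreal"
  assumes [measurable]: "F \<in> borel_measurable borel"
    and bound: "\<And>t N. 1/2 \<le> t \<Longrightarrow> t < 1 \<Longrightarrow> (\<Sum>k<N. ennreal ((1/2) ^ k) * F ((1/2) ^ k * t)) \<le> B"
  shows "(\<integral>\<^sup>+y. F y * indicator {0<..<1} y \<partial>lborel) \<le> B"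
proof -
  let ?J = "{1/2..<1::real}"
  define D where "D k = {(1/2) ^ Suc k..<(1/2::real) ^ k}" for k :: nat
  have [measurable]: "D k \<in> sets borel" for k by (simp add: D_def)
  have "indicator {0<..<1} y \<le> (\<Sum>k. indicator (D k) y :: ennreal)" for y :: real
  proof (cases "0 < y \<and> y < 1")
    case True
    \<comment> \<open>The least such exponent selects the dyadic piece that contains y.\<close>
    define k where "k = (LEAST k. (1/2::real) ^ Suc k \<le> y)"
    obtain n where "(1/2::real) ^ n < y"
      using real_arch_pow_inv[of y "1/2"] True by auto
    then have ex: "(1/2::real) ^ Suc n \<le> y" using True by simp
    have "(1/2) ^ Suc k \<le> y" unfolding k_def by (rule LeastI, rule ex)
    moreover have "y < (1/2) ^ k"
    proof (cases k)
      case 0 then show ?thesis using True by simp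
    next
      case (Suc l)
      then have "\<not> (1/2::real) ^ Suc l \<le> y" unfolding k_def by (intro not_less_Least) simp
      then show ?thesis using Suc by simp
    qed
    ultimately have "indicator {0<..<1} y \<le> (indicator (D k) y :: ennreal)"
      by (simp add: D_def indicator_def)
    also have "\<dots> \<le> (\<Sum>k. indicator (D k) y)"
      using sum_le_suminf[of "\<lambda>k. indicator (D k) y :: ennreal" "{k}"] by simp
    finally show ?thesis .
  qed auto
  then have "(\<integral>\<^sup>+y. F y * indicator {0<..<1} y \<partial>lborel)
      \<le> (\<integral>\<^sup>+y. (\<Sum>k. F y * indicator (D k) y) \<partial>lborel)"
    by (intro nn_integral_mono) (simp add: mult_left_mono)
  also have "\<dots> = (\<Sum>k. \<integral>\<^sup>+y. F y * indicator (D k) y \<partial>lborel)"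
    by (intro nn_integral_suminf) measurable
  also have "\<dots> = (\<Sum>k. \<integral>\<^sup>+t. ennreal ((1/2) ^ k) * F ((1/2) ^ k * t) * indicator ?J t \<partial>lborel)"
  proof (intro suminf_cong)
    fix k :: nat
    have "indicator (D k) ((1/2) ^ k * t) = (indicator ?J t :: ennreal)" for t :: real
      by (auto simp: D_def indicator_def field_simps)
    then show "(\<integral>\<^sup>+y. F y * indicator (D k) y \<partial>lborel)
        = (\<integral>\<^sup>+t. ennreal ((1/2) ^ k) * F ((1/2) ^ k * t) * indicator ?J t \<partial>lborel)"
      by (subst nn_integral_real_affine[where c = "(1/2) ^ k" and t = 0])
        (simp_all add: nn_integral_cmult[symmetric] mult.assoc)
  qed
  also have "\<dots> = (\<integral>\<^sup>+t. (\<Sum>k. ennreal ((1/2) ^ k) * F ((1/2) ^ k * t) * indicator ?J t) \<partial>lborel)"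
    by (intro nn_integral_suminf[symmetric]) measurable
  also have "\<dots> \<le> (\<integral>\<^sup>+t. B * indicator ?J t \<partial>lborel)"
  proof (intro nn_integral_mono)
    fix t :: real
    show "(\<Sum>k. ennreal ((1/2) ^ k) * F ((1/2) ^ k * t) * indicator ?J t) \<le> B * indicator ?J t"
      by (cases "t \<in> ?J") (auto intro!: suminf_le_const bound)
  qed
  also have "\<dots> = B * ennreal (1/2)"
    by (simp add: nn_integral_cmult_indicator)
  also have "\<dots> \<le> B * 1"
    by (intro mult_left_mono) (simp_all del: ennreal_half)
  finally show ?thesis by simp
qed

section \<open>Nevanlinna functions and Moebius transformations\<close>

text \<open>
  The function \<open>exp (\<i> m)\<close> has modulus \<open>exp (- Im m) \<le> 1\<close> in the upper half-plane and attains the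
  value 1 of the modulus at a zero of \<open>Im m\<close>, so it is constant as soon as there is one.
\<close>

lemma nevanlinna_Im_dichotomy:
  assumes m: "nevanlinna m"
  shows "(\<forall>z. Im z > 0 \<longrightarrow> Im (m z) > 0) \<or> (\<forall>z. Im z > 0 \<longrightarrow> Im (m z) = 0)"
proof (rule disjCI)
  let ?U = "{z. Im z > 0}"
  have hol: "m holomorphic_on - \<real>" and nonneg: "\<And>z. Im z > 0 \<Longrightarrow> Im (m z) \<ge> 0"
    using m by (auto simp: nevanlinna_def)
  assume "\<not> (\<forall>z. Im z > 0 \<longrightarrow> Im (m z) = 0)"
  then obtain z1 where z1: "Im z1 > 0" "Im (m z1) \<noteq> 0" by blast
  show "\<forall>z. Im z > 0 \<longrightarrow> Im (m z) > 0"
  proof (intro allI impI, rule ccontr)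
    fix z0 :: complex assume z0: "Im z0 > 0" "\<not> Im (m z0) > 0"
    have "(\<lambda>z. exp (\<i> * m z)) constant_on ?U"
    proof (rule maximum_modulus_principle)
      show "(\<lambda>z. exp (\<i> * m z)) holomorphic_on ?U"
        by (intro holomorphic_intros holomorphic_on_subset[OF hol]) (auto simp: complex_is_Real_iff)
      show "open ?U" by (rule open_halfspace_Im_gt)
      show "connected ?U" by (intro convex_connected convex_halfspace_Im_gt)
      show "z0 \<in> ?U" using z0 by simp
      fix z assume "z \<in> ?U"
      then show "cmod (exp (\<i> * m z)) \<le> cmod (exp (\<i> * m z0))"
        using nonneg[of z] z0 by (simp add: norm_exp_eq_Re)
    qed (auto simp: open_halfspace_Im_gt)
    then have "exp (\<i> * m z1) = exp (\<i> * m z0)"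
      using z0(1) z1(1) by (auto simp: constant_on_def)
    from arg_cong[OF this, of cmod] show False
      using nonneg[OF z0(1)] z0(2) z1(2) by (simp add: norm_exp_eq_Re)
  qed
qed

lemma moebius_diff_cnj:
  assumes "of_real c * z + of_real d \<noteq> 0" "of_real c * w + of_real d \<noteq> 0"
  shows "moebius a b c d z - cnj (moebius a b c d w)
    = of_real (a * d - b * c) * (z - cnj w)
        / ((of_real c * z + of_real d) * cnj (of_real c * w + of_real d))"
proof -
  have "cnj (of_real c * w + of_real d) \<noteq> 0" 
    using assms(2) by (metis complex_cnj_zero_iff)
  then have "of_real c * cnj w + of_real d \<noteq> 0" by simp
  then show ?thesis using assms(1) by (simp add: moebius_def field_simps)
qed

text \<open>This is the case \<open>w = z\<close> of the preceding identity.\<close>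

lemma Im_moebius:
  assumes "of_real c * z + of_real d \<noteq> 0"
  shows "Im (moebius a b c d z) = (a * d - b * c) * Im z / (cmod (of_real c * z + of_real d))\<^sup>2"
proof -
  have "2 * \<i> * of_real (Im (moebius a b c d z))
      = of_real (a * d - b * c) * (2 * \<i> * of_real (Im z))
        / of_real ((cmod (of_real c * z + of_real d))\<^sup>2)"
    using moebius_diff_cnj[OF assms assms, of a b]
    by (simp only: complex_diff_cnj complex_norm_square) (simp add: mult_ac)
  also have "\<dots> = 2 * \<i> * of_real ((a * d - b * c) * Im z / (cmod (of_real c * z + of_real d))\<^sup>2)"
    by simp
  finally show ?thesis
    by (metis (no_types, lifting) complex_i_not_zero mult_cancel_left mult_eq_0_iff of_real_eq_iff zero_neq_numeral)
qed

text \<open>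
  The quotient \<open>\<bar>z - cnj w\<bar>\<^sup>2 / (Im z Im w)\<close> is a function of the hyperbolic distance of \<open>z\<close> and \<open>w\<close>.
  Its invariance is stated without division. Applied to values of a Nevanlinna function, it says that
  the kernel normalised by the weights does not change under real Moebius transformations.
\<close>

lemma moebius_invariance:
  assumes "of_real c * z + of_real d \<noteq> 0" "of_real c * w + of_real d \<noteq> 0"
  shows "(cmod (moebius a b c d z - cnj (moebius a b c d w)))\<^sup>2 * (Im z * Im w)
    = (cmod (z - cnj w))\<^sup>2 * (Im (moebius a b c d z) * Im (moebius a b c d w))"
proof -
  have "cmod (of_real c * cnj w + of_real d) = cmod (of_real c * w + of_real d)"
    by (metis complex_cnj_add complex_cnj_complex_of_real complex_cnj_mult complex_mod_cnj)
  moreover define \<delta> where "\<delta> = a * d - b * c"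
  ultimately show ?thesis
    unfolding moebius_diff_cnj[OF assms] Im_moebius[OF assms(1)] Im_moebius[OF assms(2)]
      \<delta>_def[symmetric] norm_divide norm_mult complex_mod_cnj norm_of_real power_divide
      power_mult_distrib power2_abs
    by (simp add: power2_eq_square mult_ac)
qed

section \<open>Power asymptotics on the imaginary axis\<close>

text \<open>
  On the ray, \<open>(- \<i> y)\<^sup>\<alpha> = y\<^sup>\<alpha> exp (- \<i> \<alpha> \<pi> / 2)\<close>, so the limit is \<open>- C exp (- \<i> \<alpha> \<pi> / 2)\<close>. Its
  imaginary part \<open>C sin (\<alpha> \<pi> / 2)\<close> is positive, so \<open>Im n\<close> decays no faster than \<open>\<bar>n\<bar>\<close>.
\<close>

lemma power_asymptotics_along_ray:
  fixes n :: "complex \<Rightarrow> complex" and \<alpha> C :: real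
  assumes hol: "n holomorphic_on - \<real>" and \<alpha>: "0 < \<alpha>" "\<alpha> < 1" and C: "C > 0"
    and asym: "(\<lambda>r::real. n (of_real r * \<i>)) \<sim>[at_right 0]
           (\<lambda>r. - of_real C * (- (of_real r * \<i>)) powr of_real \<alpha>)"
  defines "L \<equiv> - of_real C * (- \<i>) powr of_real \<alpha>"
  shows "((\<lambda>y. n (\<i> * of_real y) / of_real (y powr \<alpha>)) \<longlongrightarrow> L) (at_right 0)"
    and "Im L > 0"
proof -
  have "(- \<i>) powr of_real \<alpha> = exp (- (\<i> * of_real (\<alpha> * pi / 2)))"
    by (simp add: powr_def mult_ac)
  moreover have "0 < sin (\<alpha> * pi / 2)"
    using \<alpha> by (intro sin_gt_zero) (auto simp: field_simps intro: order.strict_trans1[of _ pi])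
  ultimately show "Im L > 0"
    using C by (simp add: L_def Im_exp)
  then have "L \<noteq> 0" by auto
  have g: "- of_real C * (- (of_real y * \<i>)) powr of_real \<alpha> = of_real (y powr \<alpha>) * L"
    if "y > 0" for y :: real
    using powr_times_real_left[of "of_real y" "- \<i>" "of_real \<alpha>"] that
    by (simp add: L_def powr_of_real)
  have "((\<lambda>r. L * (if n (of_real r * \<i>) = 0 \<and> - of_real C * (- (of_real r * \<i>)) powr of_real \<alpha> = 0
          then 1 else n (of_real r * \<i>) / (- of_real C * (- (of_real r * \<i>)) powr of_real \<alpha>)))
        \<longlongrightarrow> L * 1) (at_right 0)"
    by (intro tendsto_mult_left asymp_equivD[OF asym])
  moreover have "\<forall>\<^sub>F r in at_right 0. L * (if n (of_real r * \<i>) = 0 \<and> - of_real C * (- (of_real r * \<i>)) powr of_real \<alpha> = 0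
          then 1 else n (of_real r * \<i>) / (- of_real C * (- (of_real r * \<i>)) powr of_real \<alpha>))
        = n (\<i> * of_real r) / of_real (r powr \<alpha>)"
    using eventually_at_right_less[of "0::real"]
  proof eventually_elim
    case (elim r)
    show ?case unfolding g[OF elim] using elim \<open>L \<noteq> 0\<close> by (simp add: mult.commute)
  qed
  ultimately show "((\<lambda>y. n (\<i> * of_real y) / of_real (y powr \<alpha>)) \<longlongrightarrow> L) (at_right 0)"
    by (simp add: filterlim_cong)
qed

text \<open>
  The quotient of \<open>f\<close> and the power extends continuously to the compact interval \<open>[0, 1]\<close> with value \<open>L\<close>
  at 0, and the extension has positive imaginary part everywhere. The constants are the extrema of its
  modulus and imaginary part.
\<close>

lemma comparable_to_power_on_unit_interval:
  fixes f :: "real \<Rightarrow> complex"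
  assumes cont: "continuous_on {0<..1} f"
    and lim: "((\<lambda>y. f y / of_real (y powr \<alpha>)) \<longlongrightarrow> L) (at_right 0)" and L: "Im L > 0"
    and pos: "\<And>y. 0 < y \<Longrightarrow> y \<le> 1 \<Longrightarrow> Im (f y) > 0"
  obtains A a where "A > 0" "a > 0"
    "\<And>y. 0 < y \<Longrightarrow> y \<le> 1 \<Longrightarrow> cmod (f y) \<le> A * y powr \<alpha>"
    "\<And>y. 0 < y \<Longrightarrow> y \<le> 1 \<Longrightarrow> a * y powr \<alpha> \<le> Im (f y)"
proof -
  define q where "q y = (if y = 0 then L else f y / of_real (y powr \<alpha>))" for y
  have q: "continuous_on {0..1} q"
    unfolding continuous_on_eq_continuous_within
  proof
    fix y :: real assume y: "y \<in> {0..1}"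
    show "continuous (at y within {0..1}) q"
    proof (cases "y = 0")
      case True
      have "(q \<longlongrightarrow> L) (at_right 0) \<longleftrightarrow> ((\<lambda>y. f y / of_real (y powr \<alpha>)) \<longlongrightarrow> L) (at_right 0)"
        by (intro filterlim_cong refl) (auto simp: q_def eventually_at_filter)
      then have "(q \<longlongrightarrow> L) (at 0 within {0..1})"
        using lim by (metis at_within_Icc_at_right zero_less_one)
      then show ?thesis using True by (simp add: continuous_within q_def)
    next
      case False
      have "continuous_on {0<..1} (\<lambda>y. f y / of_real (y powr \<alpha>))"
        by (intro continuous_intros cont) auto
      then have "continuous_on {0<..1} q"
        by (rule continuous_on_eq) (auto simp: q_def)
      then have "continuous (at y within {0<..1}) q"
        using y False by (auto simp: continuous_on_eq_continuous_within)
      moreover have "at y within {0<..1} = at y within {0..1}"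
        using y False by (intro at_within_nhd[of y "{0<..}"]) auto
      ultimately show ?thesis by simp
    qed
  qed
  obtain u where u: "u \<in> {0..1}" "\<And>y. y \<in> {0..1} \<Longrightarrow> cmod (q y) \<le> cmod (q u)"
    using continuous_attains_sup[of "{0..1::real}" "\<lambda>y. cmod (q y)"] continuous_on_norm[OF q] by auto
  obtain v where v: "v \<in> {0..1}" "\<And>y. y \<in> {0..1} \<Longrightarrow> Im (q v) \<le> Im (q y)"
    using continuous_attains_inf[of "{0..1::real}" "\<lambda>y. Im (q y)"] continuous_on_Im[OF q] by auto
  have qpos: "Im (q y) > 0" if "y \<in> {0..1}" for y
    using that L pos[of y] by (auto simp: q_def)
  have f: "f y = q y * of_real (y powr \<alpha>)" if "y > 0" for y
    using that by (simp add: q_def)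
  show thesis
  proof
    show "cmod (q u) > 0" "Im (q v) > 0"
      using qpos[OF u(1)] qpos[OF v(1)] by auto
    fix y :: real assume y: "0 < y" "y \<le> 1"
    show "cmod (f y) \<le> cmod (q u) * y powr \<alpha>"
      unfolding f[OF y(1)] norm_mult using u(2)[of y] y by (simp add: mult_right_mono)
    show "Im (q v) * y powr \<alpha> \<le> Im (f y)"
      unfolding f[OF y(1)] using v(2)[of y] y by (simp add: mult_right_mono)
  qed
qed

section \<open>Boundedness of evaluation along the imaginary axis\<close>

lemma dyadic_scaling_in_unit_interval:
  fixes t :: real
  assumes "0 < t" "t < 1"
  shows "(1/2) ^ k * t \<in> {0<..<1}"
proof -
  have "(1/2) ^ k * t \<le> 1 * t"
    using assms by (intro mult_right_mono) (auto simp: power_le_one)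
  then have "(1/2) ^ k * t < 1" using assms by linarith
  then show ?thesis using assms by simp
qed

text \<open>
  The factors \<open>2\<^sup>-\<^sup>k\<close>, which are the lengths of the dyadic pieces up to a constant, compensate the
  homogeneity of degree \<open>-1\<close> of the kernel bound: the normalised Gram matrix of the
  kernel functions at the nodes is dominated by a Toeplitz matrix that decays geometrically away from
  the diagonal.
\<close>

lemma dyadic_sampling_bound:
  assumes space: "is_nevanlinna_space m H ip" and h: "h \<in> H"
    and \<alpha>: "\<alpha> < 1" and D: "D > 0"
    and pos: "\<And>y. 0 < y \<Longrightarrow> y < 1 \<Longrightarrow> Im (m (\<i> * of_real y)) > 0"
    and bound: "\<And>x y. 0 < x \<Longrightarrow> x \<le> y \<Longrightarrow> y < 1 \<Longrightarrow>
      (cmod (m (\<i> * of_real x) - cnj (m (\<i> * of_real y))))\<^sup>2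
        \<le> D\<^sup>2 * (y / x) powr \<alpha> * (Im (m (\<i> * of_real x)) * Im (m (\<i> * of_real y)))"
    and t: "1/2 \<le> t" "t < 1"
  defines "y k \<equiv> (1/2) ^ k * t" and "\<rho> \<equiv> sqrt (2 powr \<alpha> / 2)"
  shows "(\<Sum>k<N. (1/2) ^ k * ((cmod (h (\<i> * of_real (y k))))\<^sup>2 * nevanlinna_weight m (y k)))
    \<le> 4 * D / (1 - \<rho>) * Re (ip h h)"
proof -
  let ?K = "nevanlinna_kernel m"
  have "2 powr \<alpha> < (2::real) powr 1" using \<alpha> by (intro powr_less_mono) auto
  then have \<rho>: "0 \<le> \<rho>" "\<rho> < 1" by (auto simp: \<rho>_def)
  have y: "0 < y k" "y k < 1" for k
    using dyadic_scaling_in_unit_interval[of t k] t by (simp_all add: y_def)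
  define v where "v k = (1/2) ^ k * nevanlinna_weight m (y k)" for k
  have v: "0 \<le> v k" for k
    using pos[OF y] by (simp add: v_def nevanlinna_weight_def less_imp_le)
  have K: "?K (\<i> * of_real x) (\<i> * of_real y)
      = (m (\<i> * of_real x) - cnj (m (\<i> * of_real y))) / (\<i> * of_real (x + y))"
    if "0 < x" "0 < y" for x y
  proof -
    have "\<i> * of_real x \<noteq> cnj (\<i> * of_real y)" using that by (auto simp: complex_eq_iff)
    then show ?thesis by (simp add: nevanlinna_kernel_def ring_distribs)
  qed
  define E where "E i j = sqrt (v i) * sqrt (v j) * cmod (?K (\<i> * of_real (y i)) (\<i> * of_real (y j)))"
    for i j
  have E_sym: "E i j = E j i" for i j
  proof -
    have "cmod (m (\<i> * of_real (y i)) - cnj (m (\<i> * of_real (y j))))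
        = cmod (m (\<i> * of_real (y j)) - cnj (m (\<i> * of_real (y i))))"
      by (metis complex_cnj_cnj complex_cnj_diff complex_mod_cnj norm_minus_commute)
    then show ?thesis
      unfolding E_def K[OF y(1) y(1)] norm_divide by (simp add: norm_mult add.commute mult_ac)
  qed
  \<comment> \<open>At distance p from the diagonal the nodes have ratio \<open>2\<^sup>p\<close>. The hypothesis contributes \<open>2\<^bsup>\<alpha> p\<^esup>\<close> and the
     factors of the nodes contribute \<open>2\<^sup>-\<^sup>p\<close> to the square; \<open>t \<ge> 1/2\<close> costs a factor 4.\<close>
  have E_le: "E (j + p) j \<le> 2 * D * \<rho> ^ p" for j p
  proof (rule power2_le_imp_le)
    let ?i = "j + p"
    define P where "P = Im (m (\<i> * of_real (y ?i))) * Im (m (\<i> * of_real (y j)))"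
    have P: "P > 0" using pos y by (simp add: P_def)
    have "(1/2::real) ^ p \<le> 1" by (simp add: power_le_one)
    from mult_right_mono[OF this, of "y j"]
    have le: "y ?i \<le> y j" using y(1)[of j] by (simp add: y_def power_add mult_ac)
    have "y j / y ?i = 2 ^ p"
      using t by (simp add: y_def power_add field_simps)
    then have ratio: "(y j / y ?i) powr \<alpha> = (2 powr \<alpha>) ^ p"
      by (simp add: powr_realpow[symmetric] powr_powr powr_power mult.commute)
    \<comment> \<open>The denominator of the kernel has modulus \<open>x + y\<close>; only the larger summand matters.\<close>
    have "cmod (?K (\<i> * of_real (y ?i)) (\<i> * of_real (y j)))
        \<le> cmod (m (\<i> * of_real (y ?i)) - cnj (m (\<i> * of_real (y j)))) / y j"
      unfolding K[OF y(1) y(1)] norm_divide using y(1)[of j] y(1)[of ?i]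
      by (intro divide_left_mono) (auto simp: norm_mult simp del: of_real_add)
    then have "(cmod (?K (\<i> * of_real (y ?i)) (\<i> * of_real (y j))))\<^sup>2
        \<le> (cmod (m (\<i> * of_real (y ?i)) - cnj (m (\<i> * of_real (y j)))) / y j)\<^sup>2"
      by (intro power_mono) auto
    also have "\<dots> \<le> D\<^sup>2 * (2 powr \<alpha>) ^ p * P / (y j)\<^sup>2"
      unfolding power_divide using bound[OF y(1) le y(2)] by (intro divide_right_mono) (auto simp: ratio P_def)
    also have "\<dots> \<le> D\<^sup>2 * (2 powr \<alpha>) ^ p * P / ((1/2) ^ j * (1/2))\<^sup>2"
      using t P by (intro divide_left_mono power_mono mult_nonneg_nonneg) (auto simp: y_def)
    finally have K2: "(cmod (?K (\<i> * of_real (y ?i)) (\<i> * of_real (y j))))\<^sup>2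
        \<le> D\<^sup>2 * (2 powr \<alpha>) ^ p * P / ((1/2) ^ j * (1/2))\<^sup>2" .
    have "(E ?i j)\<^sup>2 = v ?i * v j * (cmod (?K (\<i> * of_real (y ?i)) (\<i> * of_real (y j))))\<^sup>2"
      by (simp add: E_def power_mult_distrib v)
    also have "\<dots> \<le> v ?i * v j * (D\<^sup>2 * (2 powr \<alpha>) ^ p * P / ((1/2) ^ j * (1/2))\<^sup>2)"
      by (intro mult_left_mono K2) (simp add: v)
    also have "v ?i * v j = (1/2) ^ ?i * (1/2) ^ j / P"
      by (simp add: v_def nevanlinna_weight_def P_def)
    also have "(1/2) ^ ?i * (1/2) ^ j / P * (D\<^sup>2 * (2 powr \<alpha>) ^ p * P / ((1/2) ^ j * (1/2))\<^sup>2)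
        = 4 * D\<^sup>2 * (2 powr \<alpha> / 2) ^ p"
      using P by (simp add: power_add power2_eq_square power_divide field_simps)
    also have "(2 powr \<alpha> / 2) ^ p = (\<rho>\<^sup>2) ^ p"
      by (simp add: \<rho>_def)
    also have "(\<rho>\<^sup>2) ^ p = (\<rho> ^ p)\<^sup>2"
      by (simp only: power_mult[symmetric] mult.commute)
    also have "4 * D\<^sup>2 * (\<rho> ^ p)\<^sup>2 = (2 * D * \<rho> ^ p)\<^sup>2"
      by (simp add: power_mult_distrib)
    finally show "(E ?i j)\<^sup>2 \<le> (2 * D * \<rho> ^ p)\<^sup>2" .
  qed (use D \<rho> in auto)
  have E_dist: "E i j \<le> 2 * D * \<rho> ^ nat \<bar>int i - int j\<bar>" for i j
  proof (cases "j \<le> i")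
    case True
    then show ?thesis using E_le[of j "i - j"] by (simp add: nat_diff_distrib flip: of_nat_diff)
  next
    case False
    then show ?thesis using E_le[of i "j - i"] E_sym[of i j] by (simp add: nat_diff_distrib)
  qed
  have row: "(\<Sum>j<N. E i j) \<le> 4 * D / (1 - \<rho>)" for i
  proof -
    have "(\<Sum>j<N. E i j) \<le> (\<Sum>j<N. 2 * D * \<rho> ^ nat \<bar>int i - int j\<bar>)"
      by (intro sum_mono E_dist)
    also have "\<dots> \<le> 2 * D * (2 / (1 - \<rho>))"
      unfolding sum_distrib_left[symmetric]
      using D by (intro mult_left_mono sum_power_distance_le \<rho>) auto
    finally show ?thesis by simp
  qed
  have "(\<Sum>k<N. v k * (cmod (h (\<i> * of_real (y k))))\<^sup>2) \<le> 4 * D / (1 - \<rho>) * Re (ip h h)"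
  proof (rule rkhs_sampling_bound[where x = "\<lambda>k. \<i> * of_real (y k)" and v = v and f = h and ip = ip])
    show "reproducing_kernel_hilbert_space (- \<real>) ?K H ip"
      using space by (simp add: is_nevanlinna_space_def)
    show "\<i> * of_real (y k) \<in> - \<real>" for k
      using y(1)[of k] by (simp add: complex_is_Real_iff)
    show "(\<Sum>j<N. sqrt (v i) * sqrt (v j) * cmod (?K (\<i> * of_real (y i)) (\<i> * of_real (y j))))
        \<le> 4 * D / (1 - \<rho>)" for i
      using row by (simp add: E_def)
  qed (use D \<rho> v h in auto)
  then show ?thesis by (simp add: v_def mult_ac)
qed

text \<open>
  The hypothesis bounds the numerator of the kernel: the normalised kernel is then at most
  \<open>D (y / x)\<^bsup>\<alpha>/2\<^esup> / y\<close> for \<open>x \<le> y\<close>. The exponent \<open>\<alpha> < 1\<close> is what makes the dyadic matrices bounded.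
\<close>

lemma has_B0_property_if_kernel_bound:
  assumes m: "nevanlinna m" and \<alpha>: "\<alpha> < 1" and D: "D > 0"
    and pos: "\<And>y. 0 < y \<Longrightarrow> y < 1 \<Longrightarrow> Im (m (\<i> * of_real y)) > 0"
    and bound: "\<And>x y. 0 < x \<Longrightarrow> x \<le> y \<Longrightarrow> y < 1 \<Longrightarrow>
      (cmod (m (\<i> * of_real x) - cnj (m (\<i> * of_real y))))\<^sup>2
        \<le> D\<^sup>2 * (y / x) powr \<alpha> * (Im (m (\<i> * of_real x)) * Im (m (\<i> * of_real y)))"
  shows "has_B0_property m"
  unfolding has_B0_property_def
proof (intro allI impI)
  fix H ip assume space: "is_nevanlinna_space m H ip"
  define B where "B = 4 * D / (1 - sqrt (2 powr \<alpha> / 2))"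
  let ?I = "{0<..<1::real}" and ?w = "nevanlinna_weight m"
  have "2 powr \<alpha> < (2::real) powr 1" using \<alpha> by (intro powr_less_mono) auto
  then have B: "0 \<le> B" using D by (simp add: B_def)
  show "\<exists>C. \<forall>h\<in>H. in_weighted_L2 ?w ?I (\<lambda>y. h (\<i> * of_real y)) \<and>
      weighted_L2_norm ?w ?I (\<lambda>y. h (\<i> * of_real y)) \<le> C * hilbert_norm ip h"
  proof (intro exI[of _ "sqrt B"] ballI)
    fix h assume h: "h \<in> H"
    define F where "F y = (norm (h (\<i> * of_real y)))\<^sup>2 * ?w y" for y :: real
    have axis: "(\<lambda>y. \<i> * of_real y) ` ?I \<subseteq> - \<real>"
      by (auto simp: complex_is_Real_iff)
    have cont: "continuous_on ?I (\<lambda>y. f (\<i> * of_real y))" if "f holomorphic_on - \<real>" for f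
      by (rule continuous_on_compose2[OF holomorphic_on_imp_continuous_on[OF that] _ axis])
        (intro continuous_intros)
    have h_cont: "continuous_on ?I (\<lambda>y. h (\<i> * of_real y))"
      using space h by (intro cont) (simp add: is_nevanlinna_space_def)
    have "continuous_on ?I ?w"
      unfolding nevanlinna_weight_def using m pos
      by (intro continuous_intros cont) (auto simp: nevanlinna_def less_le)
    then have F_cont: "continuous_on ?I F"
      unfolding F_def by (intro continuous_intros h_cont)
    have F_meas: "set_borel_measurable lborel ?I F" "set_borel_measurable lborel ?I (\<lambda>y. h (\<i> * of_real y))"
      unfolding set_borel_measurable_def
      using borel_measurable_continuous_on_indicator[OF _ F_cont] borel_measurable_continuous_on_indicator[OF _ h_cont]
      by auto
    have F_nonneg: "0 \<le> F y" if "y \<in> ?I" for y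
      using pos[of y] that by (simp add: F_def nevanlinna_weight_def)
    have Re_nonneg: "0 \<le> Re (ip h h)"
      using space h unfolding is_nevanlinna_space_def reproducing_kernel_hilbert_space_def
        hilbert_function_space_def by blast
    let ?G = "\<lambda>y. ennreal (indicator ?I y *\<^sub>R F y)"
    have "(\<integral>\<^sup>+y. ?G y \<partial>lborel) = (\<integral>\<^sup>+y. ?G y * indicator ?I y \<partial>lborel)"
      by (intro nn_integral_cong) (simp add: indicator_def)
    also have "\<dots> \<le> ennreal (B * Re (ip h h))"
    proof (rule nn_integral_unit_interval_le_dyadic)
      show "?G \<in> borel_measurable borel"
        using F_meas(1) by (simp add: set_borel_measurable_def)
      fix t :: real and N :: nat assume t: "1/2 \<le> t" "t < 1"
      have in_I: "(1/2) ^ k * t \<in> ?I" for k :: nat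
        using dyadic_scaling_in_unit_interval[of t k] t by simp
      have "(\<Sum>k<N. ennreal ((1/2) ^ k) * ?G ((1/2) ^ k * t))
          = ennreal (\<Sum>k<N. (1/2) ^ k * F ((1/2) ^ k * t))"
        using in_I F_nonneg[OF in_I] by (simp add: ennreal_mult del: greaterThanLessThan_iff flip: sum_ennreal)
      also have "\<dots> \<le> ennreal (B * Re (ip h h))"
        using dyadic_sampling_bound[OF space h \<alpha> D pos bound t, of N]
        by (intro ennreal_leI) (simp add: F_def B_def)
      finally show "(\<Sum>k<N. ennreal ((1/2) ^ k) * ?G ((1/2) ^ k * t)) \<le> ennreal (B * Re (ip h h))" .
    qed
    finally have le: "(\<integral>\<^sup>+y. ?G y \<partial>lborel) \<le> ennreal (B * Re (ip h h))" .
    have int: "set_integrable lborel ?I F"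
      unfolding set_integrable_def
    proof (rule integrableI_nonneg)
      show "(\<integral>\<^sup>+y. ?G y \<partial>lborel) < \<infinity>" using le le_less_trans ennreal_less_top by (metis infinity_ennreal_def)
    qed (use F_meas F_nonneg in \<open>auto simp: set_borel_measurable_def indicator_def\<close>)
    have "(LINT y:?I|lborel. F y) \<le> B * Re (ip h h)"
      unfolding set_lebesgue_integral_def
    proof (rule integral_real_bounded)
      show "(\<integral>\<^sup>+y. ?G y \<partial>lborel) \<le> ennreal (B * Re (ip h h))" by (rule le)
    qed (use B Re_nonneg in auto)
    then have "weighted_L2_norm ?w ?I (\<lambda>y. h (\<i> * of_real y)) \<le> sqrt B * hilbert_norm ip h"
      unfolding weighted_L2_norm_def hilbert_norm_def real_sqrt_mult[symmetric]
      by (simp add: F_def)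
    then show "in_weighted_L2 ?w ?I (\<lambda>y. h (\<i> * of_real y)) \<and>
      weighted_L2_norm ?w ?I (\<lambda>y. h (\<i> * of_real y)) \<le> sqrt B * hilbert_norm ip h"
      using int F_meas(2) by (simp add: in_weighted_L2_def F_def[abs_def])
  qed
qed

theorem corollary3p11:
  fixes m :: "complex \<Rightarrow> complex"
  assumes "m \<in> class_A0"
  shows "has_B0_property m"
proof -
  from assms obtain \<alpha> C a b c d where \<alpha>: "0 < \<alpha>" "\<alpha> < 1" and "C > 0"
    and det: "a * d - b * c \<in> {-1, 1}"
    and m: "nevanlinna m" and n: "nevanlinna (moebius a b c d \<circ> m)"
    and asym_all: "\<forall>z \<in> - \<real>. (\<lambda>r::real. (moebius a b c d \<circ> m) (of_real r * z)) \<sim>[at_right 0]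
           (\<lambda>r. - of_real C * (- (of_real r * z)) powr of_real \<alpha>)"
    unfolding class_A0_def inverse_stieltjes_def by blast
  have asym: "(\<lambda>r::real. (moebius a b c d \<circ> m) (of_real r * \<i>)) \<sim>[at_right 0]
           (\<lambda>r. - of_real C * (- (of_real r * \<i>)) powr of_real \<alpha>)"
    by (rule bspec[OF asym_all]) (simp add: complex_is_Real_iff)
  define n where "n = moebius a b c d \<circ> m"
  note n = n[folded n_def] and asym = asym[folded n_def]
  define L where "L = - of_real C * (- \<i>) powr of_real \<alpha>"
  have hol: "n holomorphic_on - \<real>" using n by (simp add: nevanlinna_def)
  have lim: "((\<lambda>y. n (\<i> * of_real y) / of_real (y powr \<alpha>)) \<longlongrightarrow> L) (at_right 0)" and L: "Im L > 0"
    using power_asymptotics_along_ray[OF hol \<alpha> \<open>C > 0\<close> asym] by (auto simp: L_def)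
  \<comment> \<open>If m were real in the upper half-plane, so would be n, against the nonreal limit along the axis.\<close>
  have "\<not> (\<forall>z. Im z > 0 \<longrightarrow> Im (m z) = 0)"
  proof
    assume real: "\<forall>z. Im z > 0 \<longrightarrow> Im (m z) = 0"
    have "Im (n (\<i> * of_real y) / of_real (y powr \<alpha>)) = 0" if "y > 0" for y
    proof -
      have "m (\<i> * of_real y) \<in> \<real>" using real that by (simp add: complex_is_Real_iff)
      then have "n (\<i> * of_real y) / of_real (y powr \<alpha>) \<in> \<real>"
        by (auto simp: n_def moebius_def elim!: Reals_cases intro!: Reals_divide Reals_add Reals_mult)
      then show ?thesis by (simp add: complex_is_Real_iff)
    qed
    then have "\<forall>\<^sub>F y in at_right 0. Im (n (\<i> * of_real y) / of_real (y powr \<alpha>)) = 0"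
      by (auto simp: eventually_at_filter)
    then have "((\<lambda>y. Im (n (\<i> * of_real y) / of_real (y powr \<alpha>))) \<longlongrightarrow> 0) (at_right 0)"
      by (rule tendsto_eventually)
    then have "Im L = 0"
      using tendsto_unique[OF _ tendsto_Im[OF lim]] by simp
    then show False using L by simp
  qed
  then have m_pos: "Im (m z) > 0" if "Im z > 0" for z
    using nevanlinna_Im_dichotomy[OF m] that by blast
  have denom: "of_real c * m z + of_real d \<noteq> 0" if "Im z > 0" for z
    using m_pos[OF that] det by (auto simp: complex_eq_iff)
  \<comment> \<open>The sign of the determinant is not known, but n maps the upper half-plane into its closure.\<close>
  have n_pos: "Im (n z) > 0" if "Im z > 0" for z
  proof -
    have "Im (n z) \<noteq> 0"
      using m_pos[OF that] det denom[OF that] by (auto simp: n_def Im_moebius[OF denom[OF that]])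
    then show ?thesis using n that by (auto simp: nevanlinna_def less_le)
  qed
  have "continuous_on {0<..1} (\<lambda>y. n (\<i> * of_real y))"
    by (rule continuous_on_compose2[OF holomorphic_on_imp_continuous_on[OF hol]])
      (auto intro!: continuous_intros simp: complex_is_Real_iff)
  from comparable_to_power_on_unit_interval[OF this lim L]
  obtain A k where A: "A > 0" and k: "k > 0"
    and upper: "\<And>y. 0 < y \<Longrightarrow> y \<le> 1 \<Longrightarrow> cmod (n (\<i> * of_real y)) \<le> A * y powr \<alpha>"
    and lower: "\<And>y. 0 < y \<Longrightarrow> y \<le> 1 \<Longrightarrow> k * y powr \<alpha> \<le> Im (n (\<i> * of_real y))"
    using n_pos by auto
  show ?thesis
  proof (rule has_B0_property_if_kernel_bound[OF m \<alpha>(2)])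
    show "2 * A / k > 0" using A k by simp
    show "Im (m (\<i> * of_real y)) > 0" if "0 < y" for y using m_pos that by simp
    fix x y :: real assume xy: "0 < x" "x \<le> y" "y < 1"
    let ?z = "\<i> * of_real x" and ?w = "\<i> * of_real y"
    have "cmod (n ?z - cnj (n ?w)) \<le> cmod (n ?z) + cmod (n ?w)"
      using norm_triangle_ineq4[of "n ?z" "cnj (n ?w)"] by simp
    also have "\<dots> \<le> A * x powr \<alpha> + A * y powr \<alpha>"
      using xy by (intro add_mono upper) auto
    also have "A * x powr \<alpha> \<le> A * y powr \<alpha>"
      using xy A \<alpha> by (intro mult_left_mono powr_mono2) auto
    finally have "(cmod (n ?z - cnj (n ?w)))\<^sup>2 \<le> (2 * A * y powr \<alpha>)\<^sup>2"
      by (intro power_mono) auto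
    also have "\<dots> = (2 * A / k)\<^sup>2 * (y / x) powr \<alpha> * ((k * x powr \<alpha>) * (k * y powr \<alpha>))"
      using xy k by (simp add: powr_divide power2_eq_square)
    also have "\<dots> \<le> (2 * A / k)\<^sup>2 * (y / x) powr \<alpha> * (Im (n ?z) * Im (n ?w))"
      using xy k n_pos[of ?z] by (intro mult_left_mono mult_mono lower) auto
    finally have n_bound: "(cmod (n ?z - cnj (n ?w)))\<^sup>2
        \<le> (2 * A / k)\<^sup>2 * (y / x) powr \<alpha> * (Im (n ?z) * Im (n ?w))" .
    have "(cmod (m ?z - cnj (m ?w)))\<^sup>2 * (Im (n ?z) * Im (n ?w))
        = (cmod (n ?z - cnj (n ?w)))\<^sup>2 * (Im (m ?z) * Im (m ?w))"
      using moebius_invariance[OF denom denom, of ?z ?w a b] xy by (simp add: n_def)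
    also have "\<dots> \<le> (2 * A / k)\<^sup>2 * (y / x) powr \<alpha> * (Im (n ?z) * Im (n ?w)) * (Im (m ?z) * Im (m ?w))"
      using n_bound m_pos[of ?z] m_pos[of ?w] xy by (intro mult_right_mono) auto
    finally have "(cmod (m ?z - cnj (m ?w)))\<^sup>2 * (Im (n ?z) * Im (n ?w))
        \<le> (2 * A / k)\<^sup>2 * (y / x) powr \<alpha> * (Im (m ?z) * Im (m ?w)) * (Im (n ?z) * Im (n ?w))"
      by (simp only: mult_ac)
    then show "(cmod (m ?z - cnj (m ?w)))\<^sup>2
        \<le> (2 * A / k)\<^sup>2 * (y / x) powr \<alpha> * (Im (m ?z) * Im (m ?w))"
      using n_pos[of ?z] n_pos[of ?w] xy by (subst (asm) mult_le_cancel_right_pos) auto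
  qed
qed

end
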